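(* Let $S$ be a recurrent specular set on the finite alphabet $A$ (so $A\subset S$). For any finite $S$-maximal bifix code $X$, one has $$\mathrm{Card}(X)=d_X(S)\,(\mathrm{Card}(A)-2)+2,$$ where $d_X(S)$ is the $S$-degree of $X$.
   Context: Words are over a finite alphabet $A$; $\varepsilon$ is the empty word. A set $S$ of words on $A$ is factorial if it contains $A$ and all the factors of its elements. For $w\in S$ let $L(w)=\{a\in A\mid aw\in S\}$, $R(w)=\{a\in A\mid wa\in S\}$, $B(w)=\{(a,b)\in A\times A\mid awb\in S\}$. A factorial set $S$ is biextendable if $B(w)\neq\emptyset$ for all $w\in S$. The extension graph $\mathcal{E}(w)$ is the undirected graph whose vertex set is the disjoint union of $L(w)$ and $R(w)$ and whose edges are the pairs in $B(w)$. A biextendable set $S$ is a tree set of characteristic $c$ if $\mathcal{E}(w)$ is a tree for every nonempty $w\in S$ and $\mathcal{E}(\varepsilon)$ is a disjoint union of $c$ trees. Let $\theta$ be an involution on $A$ (possibly with fixed points) and let $G_\theta$ be the group generated by $A$ with relations $a\theta(a)=1$, $a\in A$ (so $a^{-1}=\theta(a)$). A word is reduced if it has no factor $a\theta(a)$ with $a\in A$; every element of $G_\theta$ is represented by a unique reduced word, so the inverse of a reduced word $a_1\cdots a_n$ is the reduced word $\theta(a_n)\cdots\theta(a_1)$. A laminary set on $A$ relative to $\theta$ is a biextendable set of reduced words closed under taking inverses. A specular set is a laminary set which is a tree set of characteristic $2$. A set $S\ne\{\varepsilon\}$ is recurrent if it is factorial and for all $u,w\in S$ there is $v\in S$ with $uvw\in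 S$. A bifix code is a set of nonempty words in which no element is a proper prefix or a proper suffix of another. A bifix code $X\subset S$ is $S$-maximal if it is not properly contained in a bifix code $Y\subset S$. A parse of a word $w$ with respect to $X$ is a triple $(q,x,p)$ with $w=qxp$, where $q$ has no suffix in $X$, $x\in X^*$ and $p$ has no prefix in $X$. The $S$-degree $d_X(S)$ is the maximal number of parses with respect to $X$ of a word of $S$. *)

theory Defs
  imports "Graph_Theory.Digraph_Component" "HOL-Library.Sublist" "HOL-Library.Extended_Nat"
begin

section \<open>Undirected trees\<close>

text \<open>
  Undirected simple graphs are symmetric loop-free digraphs (\<open>pair_graph\<close>).  The library's
  \<open>tree\<close> forbids all directed cycles and hence also the closed walk u, v, u along a
  single undirected edge, so it is not the notion for undirected graphs.  The cycles of an
  undirected simple graph are the library cycles of length at least 3.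
\<close>

definition undirected_tree :: "'v pair_pre_digraph \<Rightarrow> bool" where
  "undirected_tree G \<longleftrightarrow> pair_graph G \<and> connected (with_proj G) \<and>
     \<not> (\<exists>p. pre_digraph.cycle (with_proj G) p \<and> 3 \<le> length p)"

definition disjoint_union_of_trees :: "nat \<Rightarrow> 'v pair_pre_digraph \<Rightarrow> bool" where
  "disjoint_union_of_trees c G \<longleftrightarrow>
     (\<exists>T. finite T \<and> card T = c \<and> (\<forall>H\<in>T. undirected_tree H) \<and>
        (\<forall>H\<in>T. \<forall>K\<in>T. H \<noteq> K \<longrightarrow> pverts H \<inter> pverts K = {}) \<and>
        pverts G = (\<Union>H\<in>T. pverts H) \<and> parcs G = (\<Union>H\<in>T. parcs H))"

section \<open>Factorial sets and extension graphs\<close>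

definition factorial :: "'a set \<Rightarrow> 'a list set \<Rightarrow> bool" where
  "factorial A S \<longleftrightarrow> S \<subseteq> lists A \<and> (\<forall>a\<in>A. [a] \<in> S) \<and> (\<forall>w\<in>S. \<forall>u. sublist u w \<longrightarrow> u \<in> S)"

definition left_ext :: "'a set \<Rightarrow> 'a list set \<Rightarrow> 'a list \<Rightarrow> 'a set" where
  "left_ext A S w = {a \<in> A. a # w \<in> S}"

definition right_ext :: "'a set \<Rightarrow> 'a list set \<Rightarrow> 'a list \<Rightarrow> 'a set" where
  "right_ext A S w = {a \<in> A. w @ [a] \<in> S}"

definition bi_ext :: "'a set \<Rightarrow> 'a list set \<Rightarrow> 'a list \<Rightarrow> ('a \<times> 'a) set" where
  "bi_ext A S w = {(a, b) \<in> A \<times> A. a # w @ [b] \<in> S}"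

definition biextendable :: "'a set \<Rightarrow> 'a list set \<Rightarrow> bool" where
  "biextendable A S \<longleftrightarrow> factorial A S \<and> (\<forall>w\<in>S. bi_ext A S w \<noteq> {})"

text \<open>Every undirected edge is represented by its two orientations.\<close>

definition extension_graph ::
    "'a set \<Rightarrow> 'a list set \<Rightarrow> 'a list \<Rightarrow> ('a + 'a) pair_pre_digraph" where
  "extension_graph A S w =
     \<lparr> pverts = left_ext A S w <+> right_ext A S w,
       parcs = (\<Union>(a, b)\<in>bi_ext A S w. {(Inl a, Inr b), (Inr b, Inl a)}) \<rparr>"

definition tree_set :: "'a set \<Rightarrow> nat \<Rightarrow> 'a list set \<Rightarrow> bool" where
  "tree_set A c S \<longleftrightarrow> biextendable A S \<and>
     (\<forall>w\<in>S. w \<noteq> [] \<longrightarrow> undirected_tree (extension_graph A S w)) \<and>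
     disjoint_union_of_trees c (extension_graph A S [])"

section \<open>Specular sets\<close>

definition involution_on :: "'a set \<Rightarrow> ('a \<Rightarrow> 'a) \<Rightarrow> bool" where
  "involution_on A \<theta> \<longleftrightarrow> (\<forall>a\<in>A. \<theta> a \<in> A \<and> \<theta> (\<theta> a) = a)"

definition reduced :: "'a set \<Rightarrow> ('a \<Rightarrow> 'a) \<Rightarrow> 'a list \<Rightarrow> bool" where
  "reduced A \<theta> w \<longleftrightarrow> (\<forall>a\<in>A. \<not> sublist [a, \<theta> a] w)"

text \<open>
  The reduced word that represents the inverse, in the group generated by the alphabet with
  relations \<open>a (\<theta> a) = 1\<close>, of the element represented by the reduced word \<open>w\<close>.
\<close>

definition inverse_word :: "('a \<Rightarrow> 'a) \<Rightarrow> 'a list \<Rightarrow> 'a list" where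
  "inverse_word \<theta> w = rev (map \<theta> w)"

definition laminary :: "'a set \<Rightarrow> ('a \<Rightarrow> 'a) \<Rightarrow> 'a list set \<Rightarrow> bool" where
  "laminary A \<theta> S \<longleftrightarrow> biextendable A S \<and> (\<forall>w\<in>S. reduced A \<theta> w) \<and> (\<forall>w\<in>S. inverse_word \<theta> w \<in> S)"

definition specular :: "'a set \<Rightarrow> ('a \<Rightarrow> 'a) \<Rightarrow> 'a list set \<Rightarrow> bool" where
  "specular A \<theta> S \<longleftrightarrow> laminary A \<theta> S \<and> tree_set A 2 S"

definition recurrent :: "'a set \<Rightarrow> 'a list set \<Rightarrow> bool" where
  "recurrent A S \<longleftrightarrow> S \<noteq> {[]} \<and> factorial A S \<and> (\<forall>u\<in>S. \<forall>w\<in>S. \<exists>v\<in>S. u @ v @ w \<in> S)"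

section \<open>Bifix codes and degree\<close>

definition bifix_code :: "'a list set \<Rightarrow> bool" where
  "bifix_code X \<longleftrightarrow> [] \<notin> X \<and>
     (\<forall>x\<in>X. \<forall>y\<in>X. \<not> strict_prefix x y \<and> \<not> strict_suffix x y)"

definition maximal_bifix_code :: "'a list set \<Rightarrow> 'a list set \<Rightarrow> bool" where
  "maximal_bifix_code S X \<longleftrightarrow> bifix_code X \<and> X \<subseteq> S \<and>
     \<not> (\<exists>Y. bifix_code Y \<and> Y \<subseteq> S \<and> X \<subset> Y)"

text \<open>\<open>concat ` lists X\<close> is the submonoid generated by \<open>X\<close>.\<close>

definition parses :: "'a list set \<Rightarrow> 'a list \<Rightarrow> ('a list \<times> 'a list \<times> 'a list) set" where
  "parses X w = {(q, x, p). w = q @ x @ p \<and> (\<forall>u\<in>X. \<not> suffix u q) \<and>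
     x \<in> concat ` lists X \<and> (\<forall>u\<in>X. \<not> prefix u p)}"

text \<open>
  Each word has finitely many parses, but the number of parses may be unbounded
  on \<open>S\<close>; the degree is \<open>\<infinity>\<close> in that case.
\<close>

definition S_degree :: "'a list set \<Rightarrow> 'a list set \<Rightarrow> enat" where
  "S_degree X S = (SUP w\<in>S. enat (card (parses X w)))"

end

theory Submission
  imports Defs
begin

text \<open>
  Since a tree has one edge less than vertices, the numbers \<open>\<rho>(w) = Card(R(w)) - 1\<close>, with
  \<open>\<rho>(\<epsilon>) = Card(A) - 2\<close>, satisfy \<open>\<rho>(w) = (\<Sum>a\<in>L(w). \<rho>(aw))\<close>.  Recurrence shows that every word
  of \<open>S\<close> is comparable with an element of \<open>X\<close> both for the prefix and for the suffix order, that
  the parses of \<open>w\<close> correspond to the suffixes of \<open>w\<close> in the set \<open>P\<close> of proper prefixes of \<open>X\<close>, and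
  that all long words have the same number \<open>d\<close> of parses.  Summing \<open>\<rho>(w)\<close> times the number of
  parses of \<open>w\<close> over all words of a large fixed length gives
  \<open>d (Card(A) - 2) = (\<Sum>p\<in>P. \<rho>(p))\<close>, and counting the leaves of the prefix tree of \<open>X\<close> gives
  \<open>Card(X) = 1 + (\<Sum>p\<in>P. Card(R(p)) - 1)\<close>.
\<close>

section \<open>Counting arcs of trees\<close>

text \<open>A vertex set is grown from a single vertex, one vertex at a time. Connectedness supplies
  an arc leaving the set, and the absence of cycles makes its endpoint adjacent to only one vertex
  of the set, so each step adds one edge, that is, two arcs.\<close>

lemma undirected_tree_card_arcs:
  assumes tree: "undirected_tree G"
  shows "card (parcs G) + 2 = 2 * card (pverts G)"
proof -
  interpret pair_graph G using tree by (simp add: undirected_tree_def)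
  have conn: "strongly_connected (with_proj G)"
    using tree sym_arcs by (auto simp: undirected_tree_def intro: symmetric_connected_imp_strongly_connected)
  have sym: "(v, u) \<in> parcs G" if "(u, v) \<in> parcs G" for u v
    using sym_arcs that by (auto simp: symmetric_def sym_def)
  have noloop: "(u, u) \<notin> parcs G" for u
    using pair_no_loops by force
  define inner where "inner U = parcs G \<inter> U \<times> U" for U
  \<comment> \<open>Paths have to stay inside \<open>U\<close>, so that one of them can later be
    closed through a vertex outside \<open>U\<close> without repeating a vertex.\<close>
  define good where "good U \<longleftrightarrow> U \<subseteq> pverts G \<and>
    (\<forall>u\<in>U. \<forall>v\<in>U. \<exists>p. apath u p v \<and> set (pawalk_verts u p) \<subseteq> U) \<and>
    card (inner U) + 2 = 2 * card U" for U
  have step: "\<exists>v. v \<notin> U \<and> good (insert v U)" if U: "good U" "U \<noteq> pverts G" for U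
  proof -
    have sub: "U \<subseteq> pverts G" and ne: "U \<noteq> {}" and fin: "finite U"
      using U pair_finite_verts by (auto simp: good_def dest: finite_subset)
    have "\<exists>u v. u \<in> U \<and> v \<notin> U \<and> (u, v) \<in> parcs G"
    proof (rule ccontr)
      assume no: "\<not> ?thesis"
      obtain u v where uv: "u \<in> U" "v \<in> pverts G" "v \<notin> U" using ne sub U(2) by blast
      have "(u, v) \<in> rtrancl_on (pverts G) (parcs G)"
        using conn uv sub by (auto simp: strongly_connected_def reachable_def)
      then have "v \<in> U"
        by (induction rule: rtrancl_on_induct) (use uv no in auto)
      with uv show False by simp
    qed
    then obtain u v where uv: "u \<in> U" "v \<notin> U" "(u, v) \<in> parcs G" by blast
    have vV: "v \<in> pverts G" using uv in_arcsD2 by blast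
    \<comment> \<open>A second neighbour \<open>u'\<close> of \<open>v\<close> in \<open>U\<close>
      would close the path from \<open>u\<close> to \<open>u'\<close> to a cycle through
      \<open>v\<close>. As \<open>u\<close> and \<open>u'\<close> differ, its length is at least 3,
      so it is not a mere return along one edge.\<close>
    have uniq: "u' = u" if u': "u' \<in> U" "(u', v) \<in> parcs G" for u'
    proof (rule ccontr)
      assume neq: "u' \<noteq> u"
      obtain p where p: "apath u p u'" "set (pawalk_verts u p) \<subseteq> U"
        using U uv(1) u'(1) unfolding good_def by blast
      have "p \<noteq> []" using p neq by (auto simp: apath_def awalk_def)
      define c where "c = (v, u) # p @ [(u', v)]"
      have "awalk v c v"
        using p u' uv vV sym[of u v] by (auto simp: c_def apath_def awalk_Cons_iff intro!: awalk_appendI[of _ _ u'] arc_implies_awalk[of "(u', v)", simplified])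
      moreover have "pawalk_verts v c = v # pawalk_verts u p @ [v]"
      proof -
        have "pawalk_verts u (p @ [(u', v)]) = pawalk_verts u p @ [v]" if "pcas u p u'" for u
          using that by (induction p arbitrary: u) auto
        then show ?thesis using p by (simp add: c_def apath_def awalk_def)
      qed
      ultimately have "cycle c"
        using p uv unfolding cycle_def by (auto simp: apath_def c_def intro!: exI[of _ v])
      moreover have "3 \<le> length c" using \<open>p \<noteq> []\<close> by (cases p) (auto simp: c_def)
      ultimately show False using tree by (auto simp: undirected_tree_def)
    qed
    have in_eq: "inner (insert v U) = inner U \<union> {(u, v), (v, u)}"
      using uv sym[OF uv(3)] by (auto simp: inner_def noloop dest: uniq uniq[OF _ sym])
    have "card (inner (insert v U)) = card (inner U) + 2"
    proof -
      have "inner U \<inter> {(u, v), (v, u)} = {}" "finite (inner U)" "u \<noteq> v"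
        using uv fin by (auto simp: inner_def)
      then show ?thesis unfolding in_eq by (subst card_Un_disjoint) auto
    qed
    moreover have "\<exists>p. apath x p y \<and> set (pawalk_verts x p) \<subseteq> insert v U"
      if xy: "x \<in> insert v U" "y \<in> insert v U" for x y
    proof -
      have vrefl: "apath v [] v" using vV by (simp add: apath_def awalk_def)
      have old: "\<exists>p. apath x p y \<and> set (pawalk_verts x p) \<subseteq> U" if "x \<in> U" "y \<in> U" for x y
        using U that unfolding good_def by blast
      consider "x \<in> U" "y \<in> U" | "x = v" "y = v" | "x = v" "y \<in> U" | "x \<in> U" "y = v"
        using xy by blast
      then show ?thesis
      proof cases
        case 1 with old show ?thesis by blast
      next
        case 2 with vrefl show ?thesis by (intro exI[of _ "[]"]) auto
      next
        case 3
        obtain p where p: "apath u p y" "set (pawalk_verts u p) \<subseteq> U" using old[OF uv(1) 3(2)] by blast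
        then show ?thesis using 3 uv sym[of u v] vV
          by (intro exI[of _ "(v, u) # p"]) (auto simp: apath_def awalk_Cons_iff)
      next
        case 4
        obtain p where p: "apath x p u" "set (pawalk_verts x p) \<subseteq> U" using old[OF 4(1) uv(1)] by blast
        have "pawalk_verts x (p @ [(u, v)]) = pawalk_verts x p @ [v]" if "pcas x p u" for x
          using that by (induction p arbitrary: x) auto
        moreover have "pcas x p u" using p by (simp add: apath_def awalk_def)
        moreover have "awalk x (p @ [(u, v)]) v"
          using p uv by (auto simp: apath_def intro!: awalk_appendI[of _ _ u] arc_implies_awalk[of "(u, v)", simplified])
        ultimately show ?thesis using 4 uv p
          by (intro exI[of _ "p @ [(u, v)]"]) (auto simp: apath_def)
      qed
    qed
    ultimately have "good (insert v U)"
      using U sub vV uv fin unfolding good_def by auto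
    with uv show ?thesis by blast
  qed
  obtain r where r: "r \<in> pverts G" using conn by (auto simp: strongly_connected_def)
  have "good {r}"
    using r noloop by (auto simp: good_def inner_def apath_def awalk_def intro!: exI[of _ "[]"])
  \<comment> \<open>Good sets exist in every positive size up to the number of vertices; the largest
    one is the whole vertex set.\<close>
  have "\<exists>U. good U \<and> card U = Suc n" if "Suc n \<le> card (pverts G)" for n
    using that
  proof (induction n)
    case 0
    show ?case using \<open>good {r}\<close> by (intro exI[of _ "{r}"]) auto
  next
    case (Suc n)
    then obtain U where U: "good U" "card U = Suc n" by auto
    with Suc.prems have "U \<noteq> pverts G" by auto
    then obtain v where v: "v \<notin> U" "good (insert v U)" using step U by blast
    have "finite U" using U(2) card.infinite by fastforce
    with U v show ?case by (intro exI[of _ "insert v U"]) auto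
  qed
  moreover have "card (pverts G) \<noteq> 0" using r pair_finite_verts by auto
  ultimately obtain U where U: "good U" "card U = card (pverts G)"
    by (metis not0_implies_Suc order_refl)
  then have "U = pverts G" using pair_finite_verts card_subset_eq[of "pverts G" U] by (simp add: good_def)
  moreover have "inner (pverts G) = parcs G" using in_arcsD1 in_arcsD2 by (auto simp: inner_def)
  ultimately show ?thesis using U by (auto simp: good_def)
qed

lemma disjoint_union_of_trees_card_arcs:
  assumes "disjoint_union_of_trees c G"
  shows "card (parcs G) + 2 * c = 2 * card (pverts G)"
proof -
  obtain T where T: "finite T" "card T = c" "\<forall>H\<in>T. undirected_tree H"
    "\<forall>H\<in>T. \<forall>K\<in>T. H \<noteq> K \<longrightarrow> pverts H \<inter> pverts K = {}"
    "pverts G = (\<Union>H\<in>T. pverts H)" "parcs G = (\<Union>H\<in>T. parcs H)"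
    using assms unfolding disjoint_union_of_trees_def by (elim exE conjE)
  have pg: "pair_graph H" if "H \<in> T" for H using T that by (auto simp: undirected_tree_def)
  have fin: "finite (pverts H)" "finite (parcs H)" "parcs H \<subseteq> pverts H \<times> pverts H" if "H \<in> T" for H
  proof -
    interpret pair_graph H using pg that .
    show "finite (pverts H)" "finite (parcs H)" by (fact pair_finite_verts pair_finite_arcs)+
    show "parcs H \<subseteq> pverts H \<times> pverts H" using in_arcsD1 in_arcsD2 by auto
  qed
  have "card (pverts G) = (\<Sum>H\<in>T. card (pverts H))"
    unfolding T(5) using T fin by (intro card_UN_disjoint) auto
  moreover have "card (parcs G) = (\<Sum>H\<in>T. card (parcs H))"
    unfolding T(6)
  proof (intro card_UN_disjoint ballI impI)
    fix H K assume "H \<in> T" "K \<in> T" "H \<noteq> K"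
    then show "parcs H \<inter> parcs K = {}" using T(4) fin(3)[of H] fin(3)[of K] by blast
  qed (use T fin in auto)
  moreover have "(\<Sum>H\<in>T. card (parcs H) + 2) = (\<Sum>H\<in>T. 2 * card (pverts H))"
    using T(3) undirected_tree_card_arcs by (intro sum.cong) auto
  ultimately show ?thesis using T(2) by (simp only: sum.distrib sum_distrib_left sum_constant) simp
qed

section \<open>Weights of words\<close>

lemma card_extension_graph:
  fixes A :: "'a set"
  assumes "finite A"
  shows "card (parcs (extension_graph A S w)) = 2 * card (bi_ext A S w)"
    and "card (pverts (extension_graph A S w)) = card (left_ext A S w) + card (right_ext A S w)"
proof -
  have fin: "finite (bi_ext A S w)"
    using assms by (auto simp: bi_ext_def intro: finite_subset[of _ "A \<times> A"])
  have eq: "parcs (extension_graph A S w) =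
      (\<lambda>(a, b). (Inl a, Inr b)) ` bi_ext A S w \<union> (\<lambda>(a, b). (Inr b, Inl a)) ` bi_ext A S w"
    by (auto simp: extension_graph_def)
  show "card (parcs (extension_graph A S w)) = 2 * card (bi_ext A S w)"
  proof -
    have "inj_on (\<lambda>(a, b). (Inl a :: 'a + 'a, Inr b :: 'a + 'a)) (bi_ext A S w)"
      "inj_on (\<lambda>(a, b). (Inr b :: 'a + 'a, Inl a :: 'a + 'a)) (bi_ext A S w)"
      by (auto simp: inj_on_def)
    then show ?thesis
      unfolding eq using fin by (subst card_Un_disjoint) (auto simp: card_image)
  qed
  show "card (pverts (extension_graph A S w)) = card (left_ext A S w) + card (right_ext A S w)"
    using assms by (simp add: extension_graph_def card_Plus left_ext_def right_ext_def)
qed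

text \<open>The characteristic is kept as a parameter; it becomes 2 only in the final
  theorem.\<close>

locale finite_tree_set =
  fixes A :: "'a set" and c :: nat and S :: "'a list set"
  assumes finite_alphabet: "finite A" and tree_set: "tree_set A c S"
begin

lemma factorial: "factorial A S"
  using tree_set by (simp add: tree_set_def biextendable_def)

lemma factor_in: "u @ v @ w \<in> S \<Longrightarrow> v \<in> S"
  using factorial unfolding factorial_def sublist_def by blast

lemma prefix_in: "u @ v \<in> S \<Longrightarrow> u \<in> S"
  using factor_in[of "[]" u v] by simp

lemma suffix_in: "u @ v \<in> S \<Longrightarrow> v \<in> S"
  using factor_in[of u v "[]"] by simp

lemma letters: "w \<in> S \<Longrightarrow> set w \<subseteq> A"
  using factorial by (auto simp: factorial_def)

text \<open>The value at the empty word is chosen so that \<open>weight_left\<close> holds there as well.\<close>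

definition weight :: "'a list \<Rightarrow> int" where
  "weight w = (if w = [] then int (card A) - int c else int (card (right_ext A S w)) - 1)"

lemma finite_ext: "finite (left_ext A S w)" "finite (right_ext A S w)"
  using finite_alphabet by (auto simp: left_ext_def right_ext_def)

text \<open>Summing Card(R(aw)) over a in L(w) gives Card(B(w)), the number of edges of the
  extension graph of \<open>w\<close>. The edge count of a tree, or of \<open>c\<close> disjoint
  trees for the empty word, then turns Card(B(w)) - Card(L(w)) into \<open>weight w\<close>.\<close>

lemma weight_left:
  assumes "w \<in> S"
  shows "(\<Sum>a\<in>left_ext A S w. weight (a # w)) = weight w"
proof -
  have "bi_ext A S w = Sigma (left_ext A S w) (\<lambda>a. right_ext A S (a # w))"
    using prefix_in[of "_ # w"] by (auto simp: bi_ext_def left_ext_def right_ext_def)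
  then have "card (bi_ext A S w) = (\<Sum>a\<in>left_ext A S w. card (right_ext A S (a # w)))"
    using finite_ext by (simp add: card_SigmaI)
  then have sum: "(\<Sum>a\<in>left_ext A S w. weight (a # w)) = int (card (bi_ext A S w)) - int (card (left_ext A S w))"
    by (simp add: weight_def sum_subtractf)
  show ?thesis
  proof (cases "w = []")
    case True
    have "left_ext A S [] = A" "right_ext A S [] = A"
      using factorial by (auto simp: left_ext_def right_ext_def factorial_def)
    moreover have "card (parcs (extension_graph A S [])) + 2 * c = 2 * card (pverts (extension_graph A S []))"
      using tree_set by (intro disjoint_union_of_trees_card_arcs) (simp add: tree_set_def)
    ultimately show ?thesis
      using sum True card_extension_graph[OF finite_alphabet, of S "[]"] by (simp add: weight_def)
  next
    case False
    have "card (parcs (extension_graph A S w)) + 2 = 2 * card (pverts (extension_graph A S w))"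
      using tree_set False assms by (intro undirected_tree_card_arcs) (simp add: tree_set_def)
    then show ?thesis
      using sum False card_extension_graph[OF finite_alphabet, of S w] by (simp add: weight_def)
  qed
qed

lemma finite_words: "finite {w \<in> S. length w = n}"
  by (rule finite_subset[OF _ finite_lists_length_eq[OF finite_alphabet, of n]]) (use letters in auto)

text \<open>This iterates \<open>weight_left\<close>: words are extended to the left, one letter at
  a time, starting from \<open>p\<close> itself.\<close>

lemma weight_suffix:
  assumes "p \<in> S" "length p \<le> n"
  shows "(\<Sum>w | w \<in> S \<and> length w = n \<and> suffix p w. weight w) = weight p"
  using assms(2)
proof (induction n rule: dec_induct)
  case base
  have "{w. w \<in> S \<and> length w = length p \<and> suffix p w} = {p}"
    using assms(1) by (auto simp: suffix_def)
  then show ?case by simp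
next
  case (step n)
  let ?W = "\<lambda>n. {w. w \<in> S \<and> length w = n \<and> suffix p w}"
  have eq: "?W (Suc n) = (\<lambda>(w, a). a # w) ` (Sigma (?W n) (left_ext A S))"
  proof (intro equalityI subsetI)
    fix w assume w: "w \<in> ?W (Suc n)"
    then obtain a v where av: "w = a # v" by (cases w) auto
    then have "v \<in> S" using w suffix_in[of "[a]" v] by simp
    \<comment> \<open>Since \<open>length p \<le> n\<close>, the word \<open>p\<close> is too short
      to be all of \<open>a # v\<close>.\<close>
    moreover have "suffix p v" using w av step.hyps by (auto simp: suffix_Cons)
    moreover have "a \<in> A" using w av letters[of w] by auto
    ultimately show "w \<in> (\<lambda>(w, a). a # w) ` (Sigma (?W n) (left_ext A S))"
      using w av by (auto simp: left_ext_def image_iff)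
  qed (auto simp: left_ext_def suffix_Cons)
  have fin: "finite (?W n)" by (rule finite_subset[OF _ finite_words[of n]]) auto
  have "(\<Sum>w\<in>?W (Suc n). weight w) = (\<Sum>(w, a)\<in>Sigma (?W n) (left_ext A S). weight (a # w))"
    unfolding eq by (subst sum.reindex) (auto simp: inj_on_def case_prod_beta)
  also have "\<dots> = (\<Sum>w\<in>?W n. \<Sum>a\<in>left_ext A S w. weight (a # w))"
    using fin finite_ext by (subst sum.Sigma) auto
  also have "\<dots> = (\<Sum>w\<in>?W n. weight w)"
    by (intro sum.cong) (auto simp: weight_left)
  finally show ?case using step.IH by simp
qed

end

section \<open>Parses\<close>

text \<open>The candidates for the first component of a parse; the next definition collects those
  for the third.\<close>

definition suffix_free_prefixes :: "'a list set \<Rightarrow> 'a list \<Rightarrow> 'a list set" where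
  "suffix_free_prefixes X w = {q. prefix q w \<and> (\<forall>u\<in>X. \<not> suffix u q)}"

definition prefix_free_suffixes :: "'a list set \<Rightarrow> 'a list \<Rightarrow> 'a list set" where
  "prefix_free_suffixes X w = {p. suffix p w \<and> (\<forall>u\<in>X. \<not> prefix u p)}"

lemma finite_suffix_free_prefixes: "finite (suffix_free_prefixes X w)"
  by (rule finite_subset[of _ "set (prefixes w)"]) (auto simp: suffix_free_prefixes_def)

lemma finite_prefix_free_suffixes: "finite (prefix_free_suffixes X w)"
  by (rule finite_subset[of _ "set (suffixes w)"]) (auto simp: prefix_free_suffixes_def)

text \<open>Elements of \<open>X\<close> are stripped greedily from the left; this terminates
  because none of them is empty.\<close>

lemma ex_factorization:
  assumes "[] \<notin> X"
  shows "\<exists>us p. v = concat us @ p \<and> us \<in> lists X \<and> (\<forall>u\<in>X. \<not> prefix u p)"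
proof (induction v rule: length_induct)
  case (1 v)
  show ?case
  proof (cases "\<exists>u\<in>X. prefix u v")
    case True
    then obtain u t where u: "u \<in> X" "v = u @ t" by (auto simp: prefix_def)
    with assms have "length t < length v" by (cases u) auto
    with 1 obtain us p where "t = concat us @ p" "us \<in> lists X" "\<forall>u\<in>X. \<not> prefix u p" by blast
    with u show ?thesis by (intro exI[of _ "u # us"] exI[of _ p]) auto
  next
    case False
    then show ?thesis by (intro exI[of _ "[]"] exI[of _ v]) auto
  qed
qed

text \<open>The two leading codewords are prefixes of the same word, hence comparable, hence equal
  in a prefix code. The conditions on \<open>p\<close> and \<open>q\<close> prevent one
  factorization from stopping before the other.\<close>

lemma unique_factorization:
  assumes "\<forall>x\<in>X. \<forall>y\<in>X. \<not> strict_prefix x y"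
    and "us \<in> lists X" "vs \<in> lists X" "\<forall>u\<in>X. \<not> prefix u p" "\<forall>u\<in>X. \<not> prefix u q"
    and "concat us @ p = concat vs @ q"
  shows "us = vs \<and> p = q"
  using assms(2,3,6)
proof (induction us arbitrary: vs)
  case Nil
  then show ?case using assms(4) by (cases vs) auto
next
  case (Cons u us)
  then obtain v ws where vs: "vs = v # ws" using assms(5) by (cases vs) auto
  have "prefix u v \<or> prefix v u"
  proof (rule prefix_same_cases)
    show "prefix u (concat (u # us) @ p)" by simp
    show "prefix v (concat (u # us) @ p)" using Cons.prems vs by simp
  qed
  then have "u = v" using Cons.hyps Cons.prems(1) vs assms(1) by (auto simp: strict_prefix_def)
  then have "us = ws \<and> p = q" using Cons.IH[of ws] Cons.prems vs by simp
  with \<open>u = v\<close> vs show ?case by simp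
qed

text \<open>A parse is determined by its first component, because the remainder of the word factors
  in exactly one way.\<close>

lemma card_parses_eq_prefixes:
  assumes "[] \<notin> X" "\<forall>x\<in>X. \<forall>y\<in>X. \<not> strict_prefix x y"
  shows "card (parses X w) = card (suffix_free_prefixes X w)"
proof -
  have "inj_on fst (parses X w)"
    by (auto simp: inj_on_def parses_def) (metis unique_factorization[OF assms(2)] in_lists_conv_set)+
  moreover have "fst ` parses X w = suffix_free_prefixes X w"
  proof (intro equalityI subsetI)
    fix q assume q: "q \<in> suffix_free_prefixes X w"
    then obtain v where v: "w = q @ v" by (auto simp: suffix_free_prefixes_def prefix_def)
    obtain us p where "v = concat us @ p" "us \<in> lists X" "\<forall>u\<in>X. \<not> prefix u p"
      using ex_factorization[OF assms(1)] by blast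
    then have "(q, concat us, p) \<in> parses X w"
      using q v by (auto simp: parses_def suffix_free_prefixes_def)
    then show "q \<in> fst ` parses X w" by force
  qed (auto simp: parses_def suffix_free_prefixes_def)
  ultimately show ?thesis using card_image by fastforce
qed

lemma concat_lists_rev: "concat ` lists (rev ` X) = rev ` concat ` lists X"
proof -
  have "lists (rev ` X) = (\<lambda>us. rev (map rev us)) ` lists X"
  proof (intro equalityI subsetI)
    fix us assume "us \<in> lists (rev ` X)"
    then show "us \<in> (\<lambda>us. rev (map rev us)) ` lists X"
      by (intro image_eqI[of _ _ "rev (map rev us)"]) (auto simp: rev_map, force)
  qed auto
  then show ?thesis by (simp add: image_image rev_concat rev_map)
qed

text \<open>Reversal exchanges the outer components of a parse. This transfers the count by first
  components to one by third components.\<close>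

lemma card_parses_rev: "card (parses (rev ` X) (rev w)) = card (parses X w)"
proof -
  let ?f = "\<lambda>(q, x, p). (rev p, rev x, rev q)"
  have sub: "?f ` parses X w \<subseteq> parses (rev ` X) (rev w)" for X and w :: "'a list"
    by (auto simp: parses_def suffix_to_prefix concat_lists_rev)
  have "bij_betw ?f (parses X w) (parses (rev ` X) (rev w))"
    using sub[of X w] sub[of "rev ` X" "rev w"]
    by (intro bij_betw_byWitness[of _ ?f]) (auto simp: image_image)
  then show ?thesis by (simp add: bij_betw_same_card)
qed

lemma card_parses_eq_suffixes:
  assumes "[] \<notin> X" "\<forall>x\<in>X. \<forall>y\<in>X. \<not> strict_suffix x y"
  shows "card (parses X w) = card (prefix_free_suffixes X w)"
proof -
  have "suffix_free_prefixes (rev ` X) (rev w) = rev ` prefix_free_suffixes X w"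
    by (force simp: suffix_free_prefixes_def prefix_free_suffixes_def suffix_to_prefix image_iff
        intro: rev_rev_ident[symmetric])
  then have "card (suffix_free_prefixes (rev ` X) (rev w)) = card (prefix_free_suffixes X w)"
    by (simp add: card_image)
  moreover have "card (parses (rev ` X) (rev w)) = card (suffix_free_prefixes (rev ` X) (rev w))"
    using assms by (intro card_parses_eq_prefixes) (auto simp: strict_suffix_to_prefix strict_suffix_def strict_prefix_def suffix_to_prefix)
  ultimately show ?thesis by (simp add: card_parses_rev)
qed

section \<open>Finite maximal bifix codes\<close>

locale finite_maximal_bifix_code = finite_tree_set +
  fixes X :: "'a list set"
  assumes c_pos: "0 < c" and recurrent: "recurrent A S"
    and finite_code: "finite X" and maximal: "maximal_bifix_code S X"
begin

lemma code: "[] \<notin> X" "\<forall>x\<in>X. \<forall>y\<in>X. \<not> strict_prefix x y" "\<forall>x\<in>X. \<forall>y\<in>X. \<not> strict_suffix x y" "X \<subseteq> S"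
  using maximal by (auto simp: maximal_bifix_code_def bifix_code_def)

lemma recurrentE:
  assumes "u \<in> S" "w \<in> S"
  obtains v where "u @ v @ w \<in> S"
  using recurrent assms unfolding recurrent_def by metis

text \<open>Over an empty alphabet the extension graph of the empty word would be empty, and its arc
  count would force \<open>c = 0\<close>.\<close>

lemma ex_letter: obtains a where "a \<in> A" "[a] \<in> S"
proof -
  have "card (parcs (extension_graph A S [])) + 2 * c = 2 * card (pverts (extension_graph A S []))"
    using tree_set by (intro disjoint_union_of_trees_card_arcs) (simp add: tree_set_def)
  then have "A \<noteq> {}"
    using c_pos by (auto simp: extension_graph_def left_ext_def right_ext_def bi_ext_def Plus_def)
  then show thesis using that factorial by (auto simp: factorial_def)
qed

lemma nil_in: "[] \<in> S"
  using ex_letter prefix_in[of "[]"] by auto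

lemma code_nonempty: "X \<noteq> {}"
proof
  assume "X = {}"
  obtain a where "[a] \<in> S" using ex_letter .
  then have "bifix_code {[a]}" "{[a]} \<subseteq> S" "X \<subset> {[a]}"
    using \<open>X = {}\<close> by (auto simp: bifix_code_def)
  then show False using maximal unfolding maximal_bifix_code_def by blast
qed

section \<open>Completeness of the code for the prefix and suffix orders\<close>

text \<open>Recurrence joins \<open>w\<close> and \<open>u\<close> to a word
  \<open>w @ v @ u\<close> of \<open>S\<close>, which could be added to \<open>X\<close> against
  maximality. So completeness can fail on one side at most.\<close>

lemma incomparable_cases:
  assumes "w \<in> S" "\<forall>x\<in>X. \<not> prefix w x \<and> \<not> prefix x w"
    and "u \<in> S" "\<forall>x\<in>X. \<not> suffix u x \<and> \<not> suffix x u"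
  shows False
proof -
  obtain v where y: "w @ v @ u \<in> S" using recurrentE assms by blast
  let ?y = "w @ v @ u"
  have "w \<noteq> []" using assms(2) code_nonempty by auto
  have pre: "\<not> prefix x ?y" "\<not> prefix ?y x" if "x \<in> X" for x
    using assms(2) that prefix_same_cases[of x ?y w] by (auto dest: append_prefixD)
  have suf: "\<not> suffix x ?y" "\<not> suffix ?y x" if "x \<in> X" for x
    using assms(4) that suffix_same_cases[of x ?y u] suffix_appendD[of "w @ v" u x] by (auto simp: suffix_def)
  have "bifix_code (insert ?y X)"
    using code \<open>w \<noteq> []\<close> pre suf by (auto simp: bifix_code_def strict_prefix_def strict_suffix_def)
  moreover have "X \<subset> insert ?y X" using pre by auto
  moreover have "insert ?y X \<subseteq> S" using y code by auto
  ultimately show False using maximal unfolding maximal_bifix_code_def by blast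
qed

text \<open>Both sides count parses. This equality links the two sides of the code in the
  completeness proofs.\<close>

lemma card_prefix_free_suffixes: "card (prefix_free_suffixes X w) = card (suffix_free_prefixes X w)"
  using card_parses_eq_prefixes card_parses_eq_suffixes code by metis

definition proper_prefixes :: "'a list set" where
  "proper_prefixes = {p. \<exists>x\<in>X. strict_prefix p x}"

lemma finite_proper_prefixes: "finite proper_prefixes"
  by (rule finite_subset[of _ "\<Union>x\<in>X. set (prefixes x)"])
    (use finite_code in \<open>auto simp: proper_prefixes_def strict_prefix_def\<close>)

lemma proper_prefixes_in: "p \<in> proper_prefixes \<Longrightarrow> p \<in> S"
  using code prefix_in by (auto simp: proper_prefixes_def strict_prefix_def prefix_def)

text \<open>
  An incomparable word on one side gives, by recurrence, words with arbitrarily many parses,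
  whereas completeness on the other side bounds the number of parses.
\<close>

lemma unbounded_prefixes:
  assumes "u \<in> S" "\<forall>x\<in>X. \<not> suffix u x \<and> \<not> suffix x u"
  shows "\<exists>w\<in>S. n \<le> card (suffix_free_prefixes X w)"
proof (induction n)
  case 0 show ?case using nil_in by auto
next
  case (Suc n)
  then obtain w where w: "w \<in> S" "n \<le> card (suffix_free_prefixes X w)" by blast
  obtain v where v: "w @ v @ u \<in> S" using recurrentE w(1) assms(1) by blast
  let ?y = "w @ v @ u"
  have "u \<noteq> []" using assms(2) code_nonempty by auto
  \<comment> \<open>A suffix of \<open>?y\<close> in \<open>X\<close> would be comparable with
    \<open>u\<close>. Hence \<open>?y\<close> itself is one more suffix-free prefix.\<close>
  have "\<not> suffix x ?y" if "x \<in> X" for x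
    using assms(2) that suffix_same_cases[of x ?y u] by (auto simp: suffix_def)
  then have "insert ?y (suffix_free_prefixes X w) \<subseteq> suffix_free_prefixes X ?y"
    by (auto simp: suffix_free_prefixes_def)
  moreover have "?y \<notin> suffix_free_prefixes X w"
    using \<open>u \<noteq> []\<close> by (auto simp: suffix_free_prefixes_def dest: prefix_length_le)
  ultimately have "Suc (card (suffix_free_prefixes X w)) \<le> card (suffix_free_prefixes X ?y)"
    using finite_suffix_free_prefixes by (metis card_insert_disjoint card_mono)
  with w v show ?case by (intro bexI[of _ ?y]) auto
qed

lemma unbounded_suffixes:
  assumes "u \<in> S" "\<forall>x\<in>X. \<not> prefix u x \<and> \<not> prefix x u"
  shows "\<exists>w\<in>S. n \<le> card (prefix_free_suffixes X w)"
proof (induction n)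
  case 0 show ?case using nil_in by auto
next
  case (Suc n)
  then obtain w where w: "w \<in> S" "n \<le> card (prefix_free_suffixes X w)" by blast
  obtain v where v: "u @ v @ w \<in> S" using recurrentE w(1) assms(1) by blast
  let ?y = "u @ v @ w"
  have "u \<noteq> []" using assms(2) code_nonempty by auto
  have "\<not> prefix x ?y" if "x \<in> X" for x
    using assms(2) that prefix_same_cases[of x ?y u] by auto
  then have "insert ?y (prefix_free_suffixes X w) \<subseteq> prefix_free_suffixes X ?y"
    by (auto simp: prefix_free_suffixes_def suffix_appendI)
  moreover have "?y \<notin> prefix_free_suffixes X w"
    using \<open>u \<noteq> []\<close> by (auto simp: prefix_free_suffixes_def dest: suffix_length_le)
  ultimately have "Suc (card (prefix_free_suffixes X w)) \<le> card (prefix_free_suffixes X ?y)"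
    using finite_prefix_free_suffixes by (metis card_insert_disjoint card_mono)
  with w v show ?case by (intro bexI[of _ ?y]) auto
qed

text \<open>If it failed, every word of \<open>S\<close> would be suffix-comparable with
  \<open>X\<close> by \<open>incomparable_cases\<close>, so suffix-free prefixes would lie among the
  finitely many suffixes of codewords. This bounds the number of parses, against
  \<open>unbounded_suffixes\<close>.\<close>

lemma right_complete:
  assumes "w \<in> S"
  shows "\<exists>x\<in>X. prefix w x \<or> prefix x w"
proof (rule ccontr)
  assume "\<not> ?thesis"
  then have w: "\<forall>x\<in>X. \<not> prefix w x \<and> \<not> prefix x w" by blast
  let ?Q = "\<Union>x\<in>X. set (suffixes x)"
  have "card (suffix_free_prefixes X v) \<le> card ?Q" if "v \<in> S" for v
  proof (rule card_mono)
    show "finite ?Q" using finite_code by auto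
    show "suffix_free_prefixes X v \<subseteq> ?Q"
    proof
      fix q assume q: "q \<in> suffix_free_prefixes X v"
      then have "q \<in> S" using that prefix_in by (auto simp: suffix_free_prefixes_def prefix_def)
      then obtain x where "x \<in> X" "suffix q x \<or> suffix x q"
        using incomparable_cases[OF assms w] by blast
      then show "q \<in> ?Q" using q by (auto simp: suffix_free_prefixes_def)
    qed
  qed
  moreover obtain v where "v \<in> S" "Suc (card ?Q) \<le> card (prefix_free_suffixes X v)"
    using unbounded_suffixes[OF assms w] by blast
  ultimately show False using card_prefix_free_suffixes[of v] by fastforce
qed

text \<open>By right completeness, a word of \<open>S\<close> with no prefix in \<open>X\<close> is
  a proper prefix of a codeword; the converse holds because \<open>X\<close> is a prefix
  code.\<close>

lemma prefix_free_suffixes_eq: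
  assumes "w \<in> S"
  shows "prefix_free_suffixes X w = {p \<in> proper_prefixes. suffix p w}"
proof (intro equalityI subsetI)
  fix p assume p: "p \<in> prefix_free_suffixes X w"
  then have "p \<in> S" using assms suffix_in by (auto simp: prefix_free_suffixes_def suffix_def)
  then obtain x where "x \<in> X" "prefix p x \<or> prefix x p" using right_complete by blast
  then show "p \<in> {p \<in> proper_prefixes. suffix p w}"
    using p by (auto simp: prefix_free_suffixes_def proper_prefixes_def strict_prefix_def)
next
  fix p assume "p \<in> {p \<in> proper_prefixes. suffix p w}"
  then show "p \<in> prefix_free_suffixes X w"
    using code(2) by (auto simp: prefix_free_suffixes_def proper_prefixes_def)
      (meson prefix_order.le_less_trans)
qed

text \<open>Right completeness already bounds the number of parses by the number of proper prefixes,
  which \<open>unbounded_prefixes\<close> would contradict.\<close>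

lemma left_complete:
  assumes "w \<in> S"
  shows "\<exists>x\<in>X. suffix w x \<or> suffix x w"
proof (rule ccontr)
  assume "\<not> ?thesis"
  then have w: "\<forall>x\<in>X. \<not> suffix w x \<and> \<not> suffix x w" by blast
  have "card (prefix_free_suffixes X v) \<le> card proper_prefixes" if "v \<in> S" for v
    using prefix_free_suffixes_eq[OF that] finite_proper_prefixes by (auto intro: card_mono)
  moreover obtain v where "v \<in> S" "Suc (card proper_prefixes) \<le> card (suffix_free_prefixes X v)"
    using unbounded_prefixes[OF assms w] by blast
  ultimately show False using card_prefix_free_suffixes[of v] by fastforce
qed

section \<open>The degree as the number of parses of long words\<close>

text \<open>An extension of \<open>w\<close> by one letter has only itself as new prefix, and being
  longer than every codeword it ends in one by left completeness. So no new first component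
  appears.\<close>

lemma card_parses_append:
  assumes "\<forall>x\<in>X. length x \<le> length w" "w @ v \<in> S"
  shows "card (parses X (w @ v)) = card (parses X w)"
  using assms(2)
proof (induction v rule: rev_induct)
  case (snoc b v)
  then have S: "(w @ v) @ [b] \<in> S" "w @ v \<in> S" using prefix_in[of "w @ v" "[b]"] by auto
  obtain x where x: "x \<in> X" "suffix ((w @ v) @ [b]) x \<or> suffix x ((w @ v) @ [b])"
    using left_complete S by blast
  moreover have "\<not> suffix ((w @ v) @ [b]) x"
    using assms(1) x(1) by (fastforce dest: suffix_length_le)
  ultimately have "suffix x ((w @ v) @ [b])" by blast
  then have "suffix_free_prefixes X ((w @ v) @ [b]) = suffix_free_prefixes X (w @ v)"
    using x by (auto simp del: append_assoc simp: suffix_free_prefixes_def prefix_snoc)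
  then have "card (parses X ((w @ v) @ [b])) = card (parses X (w @ v))"
    using card_parses_eq_prefixes code by metis
  with snoc S show ?case by simp
qed simp

lemma card_parses_prepend:
  assumes "\<forall>x\<in>X. length x \<le> length w" "v @ w \<in> S"
  shows "card (parses X (v @ w)) = card (parses X w)"
  using assms(2)
proof (induction v)
  case (Cons a v)
  then have S: "v @ w \<in> S" using suffix_in[of "[a]" "v @ w"] by auto
  obtain x where x: "x \<in> X" "prefix (a # v @ w) x \<or> prefix x (a # v @ w)"
    using right_complete Cons.prems by auto
  moreover have "\<not> prefix (a # v @ w) x"
    using assms(1) x(1) by (fastforce dest: prefix_length_le)
  ultimately have "prefix x (a # v @ w)" by blast
  then have "prefix_free_suffixes X (a # v @ w) = prefix_free_suffixes X (v @ w)"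
    using x by (auto simp: prefix_free_suffixes_def suffix_Cons)
  then have "card (parses X (a # v @ w)) = card (parses X (v @ w))"
    using card_parses_eq_suffixes code by metis
  with Cons S show ?case by simp
qed simp

lemma card_parses_mono: "card (parses X w) \<le> card (parses X (w @ v))"
proof -
  have "suffix_free_prefixes X w \<subseteq> suffix_free_prefixes X (w @ v)"
    by (auto simp: suffix_free_prefixes_def)
  then show ?thesis
    using card_parses_eq_prefixes code finite_suffix_free_prefixes card_mono by metis
qed

lemma ex_long_extension:
  assumes "w \<in> S"
  shows "\<exists>v. w @ v \<in> S \<and> n \<le> length v"
proof (induction n)
  case 0 show ?case using assms by (intro exI[of _ "[]"]) auto
next
  case (Suc n)
  then obtain v where v: "w @ v \<in> S" "n \<le> length v" by blast
  obtain a where "[a] \<in> S" using ex_letter .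
  then obtain z where "(w @ v) @ z @ [a] \<in> S" using recurrentE v by blast
  then show ?case using v by (intro exI[of _ "v @ z @ [a]"]) auto
qed

text \<open>Two long words \<open>u\<close> and \<open>w\<close> lie at the ends of a common word
  \<open>u @ v @ w\<close> of \<open>S\<close>, which has as many parses as either. Shorter words
  extend to long ones without losing parses, so the supremum is attained.\<close>

lemma S_degree_eq:
  assumes N: "\<forall>x\<in>X. length x \<le> N"
  obtains d where "S_degree X S = enat d"
    and "\<And>w. w \<in> S \<Longrightarrow> N \<le> length w \<Longrightarrow> card (parses X w) = d"
proof -
  obtain w where w: "w \<in> S" "N \<le> length w"
    using ex_long_extension[OF nil_in] by auto
  define d where "d = card (parses X w)"
  have long: "card (parses X u) = d" if u: "u \<in> S" "N \<le> length u" for u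
  proof -
    obtain v where v: "u @ v @ w \<in> S" using recurrentE u w by blast
    have "card (parses X (u @ v @ w)) = card (parses X u)"
      using N u v by (intro card_parses_append) auto
    moreover have "card (parses X ((u @ v) @ w)) = card (parses X w)"
      using N w v by (intro card_parses_prepend) auto
    ultimately show ?thesis by (simp add: d_def)
  qed
  have "card (parses X u) \<le> d" if u: "u \<in> S" for u
  proof -
    obtain v where "u @ v \<in> S" "N \<le> length v" using ex_long_extension[OF u] by blast
    then show ?thesis using long[of "u @ v"] card_parses_mono[of u v] by simp
  qed
  then have "S_degree X S = enat d"
    unfolding S_degree_def using w by (intro antisym SUP_least) (auto simp: d_def intro: SUP_upper2)
  with long show thesis using that by blast
qed

section \<open>Double counting and the cardinality formula\<close>

text \<open>Pairs of a proper prefix \<open>p\<close> and a word \<open>w\<close> of length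
  \<open>N\<close> ending in \<open>p\<close> are counted twice, each with \<open>weight w\<close>:
  for fixed \<open>p\<close> the total is \<open>weight p\<close>, for fixed \<open>w\<close> it is
  \<open>d\<close> times \<open>weight w\<close>.\<close>

lemma sum_weight_proper_prefixes:
  assumes N: "\<forall>x\<in>X. length x \<le> N"
    and d: "\<And>w. w \<in> S \<Longrightarrow> N \<le> length w \<Longrightarrow> card (parses X w) = d"
  shows "(\<Sum>p\<in>proper_prefixes. weight p) = int d * (int (card A) - int c)"
proof -
  let ?W = "{w \<in> S. length w = N}"
  have "(\<Sum>p\<in>proper_prefixes. weight p) = (\<Sum>p\<in>proper_prefixes. \<Sum>w | w \<in> ?W \<and> suffix p w. weight w)"
  proof (intro sum.cong refl)
    fix p assume p: "p \<in> proper_prefixes"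
    then have "length p \<le> N"
      using N by (force simp: proper_prefixes_def dest: prefix_length_less)
    then show "weight p = (\<Sum>w | w \<in> ?W \<and> suffix p w. weight w)"
      using weight_suffix[OF proper_prefixes_in[OF p]] by (simp add: conj_assoc)
  qed
  also have "\<dots> = (\<Sum>w\<in>?W. \<Sum>p | p \<in> proper_prefixes \<and> suffix p w. weight w)"
    by (rule sum.swap_restrict[OF finite_proper_prefixes finite_words])
  also have "\<dots> = (\<Sum>w\<in>?W. int d * weight w)"
  proof (intro sum.cong refl)
    fix w assume w: "w \<in> ?W"
    then have "card {p. p \<in> proper_prefixes \<and> suffix p w} = d"
      using d card_parses_eq_suffixes[OF code(1,3)] prefix_free_suffixes_eq by auto
    then show "(\<Sum>p | p \<in> proper_prefixes \<and> suffix p w. weight w) = int d * weight w"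
      by simp
  qed
  \<comment> \<open>The empty word is a suffix of every word, so the weights at length
    \<open>N\<close> add up to \<open>weight []\<close>.\<close>
  also have "\<dots> = int d * weight []"
    using weight_suffix[OF nil_in, of N] by (simp add: sum_distrib_left[symmetric])
  finally show ?thesis by (simp add: weight_def)
qed

text \<open>The elements of \<open>X\<close> are the leaves of a rooted tree whose inner nodes are the proper prefixes.\<close>

lemma card_code_proper_prefixes:
  "card proper_prefixes + card X = 1 + (\<Sum>p\<in>proper_prefixes. card (right_ext A S p))"
proof -
  let ?E = "Sigma proper_prefixes (right_ext A S)"
  have "(\<lambda>(p, b). p @ [b]) ` ?E = (proper_prefixes \<union> X) - {[]}"
  proof (intro equalityI subsetI)
    fix y assume "y \<in> (\<lambda>(p, b). p @ [b]) ` ?E"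
    then obtain p b where y: "y = p @ [b]" "p \<in> proper_prefixes" "y \<in> S"
      by (auto simp: right_ext_def)
    obtain x where x: "x \<in> X" "prefix y x \<or> prefix x y"
      using right_complete y(3) by blast
    obtain x' where "x' \<in> X" "strict_prefix p x'"
      using y(2) by (auto simp: proper_prefixes_def)
    \<comment> \<open>Otherwise \<open>x\<close> would be a prefix of \<open>p\<close>, hence a
      strict prefix of the codeword \<open>x'\<close>.\<close>
    then have "prefix y x"
      using x y code(2) prefix_order.le_less_trans[of x p x'] by (auto simp: prefix_snoc)
    then show "y \<in> (proper_prefixes \<union> X) - {[]}"
      using x y by (auto simp: proper_prefixes_def strict_prefix_def)
  next
    fix y assume y: "y \<in> (proper_prefixes \<union> X) - {[]}"
    then obtain x where x: "x \<in> X" "prefix y x" by (auto simp: proper_prefixes_def strict_prefix_def)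
    obtain p b where pb: "y = p @ [b]" using y by (cases y rule: rev_cases) auto
    have yS: "y \<in> S" using y code(4) proper_prefixes_in by auto
    have "strict_prefix p x"
      using x pb by (metis prefix_order.less_le_trans prefix_snoc strict_prefixI' strict_prefix_def append_self_conv not_Cons_self2)
    then have "p \<in> proper_prefixes" using x by (auto simp: proper_prefixes_def)
    moreover have "b \<in> A" using letters[OF yS] pb by auto
    ultimately show "y \<in> (\<lambda>(p, b). p @ [b]) ` ?E"
      using pb yS by (force simp: right_ext_def)
  qed
  moreover have "inj_on (\<lambda>(p, b). p @ [b]) ?E" by (auto simp: inj_on_def)
  ultimately have "card ((proper_prefixes \<union> X) - {[]}) = card ?E"
    by (metis card_image)
  moreover have "card ?E = (\<Sum>p\<in>proper_prefixes. card (right_ext A S p))"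
    using finite_proper_prefixes finite_ext by simp
  moreover have "card (proper_prefixes \<union> X) = card proper_prefixes + card X"
    using finite_proper_prefixes finite_code code(2)
    by (intro card_Un_disjoint) (auto simp: proper_prefixes_def)
  \<comment> \<open>The root is the only node not obtained by appending a letter; it accounts for
    the summand 1.\<close>
  moreover have "[] \<in> proper_prefixes"
    using code(1) code_nonempty by (auto simp: proper_prefixes_def strict_prefix_def)
  ultimately show ?thesis
    using finite_proper_prefixes finite_code by (simp add: card_Diff_singleton) (metis Suc_pred add_gr_0 card_gt_0_iff empty_iff)
qed

theorem card_code:
  obtains d where "S_degree X S = enat d"
    and "int (card X) = int d * (int (card A) - int c) + int c"
proof -
  obtain N where N: "\<forall>x\<in>X. length x \<le> N"
    using finite_code by (meson finite_imageI finite_nat_set_iff_bounded_le imageI)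
  obtain d where d: "S_degree X S = enat d" "\<And>w. w \<in> S \<Longrightarrow> N \<le> length w \<Longrightarrow> card (parses X w) = d"
    using S_degree_eq[OF N] by blast
  have nil: "[] \<in> proper_prefixes"
    using code(1) code_nonempty by (auto simp: proper_prefixes_def strict_prefix_def)
  have "right_ext A S [] = A" using factorial by (auto simp: right_ext_def factorial_def)
  \<comment> \<open>Only at the root does the weight differ from Card(R(p)) - 1. The correction
    \<open>c - 1\<close> raises the constant 1 of the leaf count to \<open>c\<close>.\<close>
  then have "int (card (right_ext A S p)) - 1 = weight p + (if p = [] then int c - 1 else 0)" for p
    by (simp add: weight_def)
  then have "(\<Sum>p\<in>proper_prefixes. int (card (right_ext A S p)) - 1) =
      (\<Sum>p\<in>proper_prefixes. weight p) + (int c - 1)"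
    using nil finite_proper_prefixes by (simp add: sum.distrib)
  moreover have "int (card proper_prefixes) + int (card X) =
      1 + (\<Sum>p\<in>proper_prefixes. int (card (right_ext A S p)))"
    using arg_cong[OF card_code_proper_prefixes, of int] by simp
  ultimately have "int (card X) = int d * (int (card A) - int c) + int c"
    using sum_weight_proper_prefixes[OF N d(2)] by (simp add: sum_subtractf)
  with d(1) show thesis using that by blast
qed

end

text \<open>The equation is stated over the integers to avoid truncated subtraction, and
  \<open>enat d\<close> records that the degree is finite.\<close>

theorem theorem4p16:
  fixes A :: "'a set" and \<theta> :: "'a \<Rightarrow> 'a" and S X :: "'a list set"
  assumes "finite A"
    and "involution_on A \<theta>"
    and "recurrent A S"
    and "specular A \<theta> S"
    and "finite X"
    and "maximal_bifix_code S X"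
  shows "\<exists>d::nat. S_degree X S = enat d \<and> int (card X) = int d * (int (card A) - 2) + 2"
proof -
  interpret finite_maximal_bifix_code A 2 S X
    using assms by unfold_locales (auto simp: specular_def)
  obtain d where "S_degree X S = enat d" "int (card X) = int d * (int (card A) - int 2) + int 2"
    using card_code .
  then show ?thesis by simp
qed

end
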